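(* Let $S\colon[0,1]^2\to[0,1]$ be a semicopula. The inequality $$I_S(\mu,f+a)\le I_S(\mu,f)+a$$ is satisfied for every measurable space $(X,\mathcal A)$, every $a\in[0,1]$, every capacity $\mu\in\mathcal M_{(X,\mathcal A)}$ and every $f\in\mathcal F_{(X,\mathcal A)}$ such that $f+a$ takes values in $[0,1]$, if and only if $$S(c+a,b)\le S(c,b)+a$$ for all $a,b,c\in[0,1]$ such that $a+c\in[0,1]$.
   Context: A measurable space $(X,\mathcal A)$ consists of a non-empty set $X$ and a $\sigma$-algebra $\mathcal A$ of subsets of $X$. $\mathcal F_{(X,\mathcal A)}$ is the class of all $\mathcal A$-measurable functions $f\colon X\to[0,1]$. A capacity on $\mathcal A$ is a set function $\mu\colon\mathcal A\to[0,1]$ that is non-decreasing with respect to inclusion and satisfies $\mu(\emptyset)=0$ and $\mu(X)=1$; $\mathcal M_{(X,\mathcal A)}$ is the class of all capacities on $\mathcal A$. A semicopula is a function $S\colon[0,1]^2\to[0,1]$ that is non-decreasing in each coordinate and has neutral element $1$, i.e. $S(x,1)=S(1,x)=x$ for all $x\in[0,1]$. The generalized Sugeno integral (seminormed fuzzy integral) of $f\in\mathcal F_{(X,\mathcal A)}$ with respect to $\mu\in\mathcal M_{(X,\mathcal A)}$ is $$I_S(\mu,f)=\sup_{t\in[0,1]}S\big(t,\mu(\{f\ge t\})\big),\qquad \{f\ge t\}=\{x\in X: f(x)\ge t\}.$$ *)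

theory Defs
  imports "HOL-Analysis.Analysis"
begin

text \<open>
  A measurable space \<open>(X, \<A>)\<close> is given by a value \<open>M :: 'a measure\<close> with \<open>X = space M\<close> and
  \<open>\<A> = sets M\<close>; the measure carried by \<open>M\<close> plays no role. Functions with domain or codomain
  \<open>[0,1]\<close> are total functions on \<open>real\<close>, constrained on the unit interval only.

  The carrier \<open>space M\<close> may be any non-empty subset of \<open>'a\<close>, so as soon as \<open>'a\<close> has two elements,
  quantifying over \<open>M\<close> covers one-point spaces as well as spaces with more than one point. On a
  one-element \<open>'a\<close> only one-point spaces exist, and statements about all measurable spaces become
  trivial.
\<close>

definition semicopula :: "(real \<Rightarrow> real \<Rightarrow> real) \<Rightarrow> bool" where
  "semicopula S \<longleftrightarrow>
     (\<forall>x\<in>{0..1}. \<forall>y\<in>{0..1}. S x y \<in> {0..1}) \<and>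
     (\<forall>y\<in>{0..1}. mono_on {0..1} (\<lambda>x. S x y)) \<and>
     (\<forall>x\<in>{0..1}. mono_on {0..1} (\<lambda>y. S x y)) \<and>
     (\<forall>x\<in>{0..1}. S x 1 = x \<and> S 1 x = x)"

definition capacities :: "'a measure \<Rightarrow> ('a set \<Rightarrow> real) set" where
  "capacities M = {\<mu>.
     (\<forall>A\<in>sets M. \<mu> A \<in> {0..1}) \<and> mono_on (sets M) \<mu> \<and> \<mu> {} = 0 \<and> \<mu> (space M) = 1}"

definition unit_measurable :: "'a measure \<Rightarrow> ('a \<Rightarrow> real) set" where
  "unit_measurable M = {f \<in> borel_measurable M. \<forall>x\<in>space M. f x \<in> {0..1}}"

text \<open>
  For a semicopula, a capacity and a function in \<^const>\<open>unit_measurable\<close>, the supremum is over a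
  non-empty subset of \<open>[0,1]\<close>, so the conditionally complete supremum on \<open>real\<close> is the true one.
\<close>

definition gen_sugeno ::
  "(real \<Rightarrow> real \<Rightarrow> real) \<Rightarrow> 'a measure \<Rightarrow> ('a set \<Rightarrow> real) \<Rightarrow> ('a \<Rightarrow> real) \<Rightarrow> real" where
  "gen_sugeno S M \<mu> f = (SUP t\<in>{0..1}. S t (\<mu> {x \<in> space M. f x \<ge> t}))"

end

theory Submission
  imports Defs
begin

text \<open>
  Shifting \<open>f\<close> by \<open>a\<close> shifts its level sets: \<open>{f + a \<ge> t} = {f \<ge> t - a}\<close>. If \<open>S\<close> satisfies the
  pointwise inequality, then each term \<open>S t (\<mu> {f + a \<ge> t})\<close> with \<open>t \<ge> a\<close> exceeds the term of \<open>f\<close> at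
  level \<open>t - a\<close> by at most \<open>a\<close>, and the terms with \<open>t < a\<close> are harmless because a semicopula lies
  below the minimum, so that they are at most \<open>t < a\<close>.

  Conversely, the pointwise inequality at \<open>a, b, c\<close> is read off from the function with value \<open>c\<close> at a
  point \<open>p\<close> and \<open>0\<close> elsewhere, and a capacity with \<open>\<mu> {p} = b\<close>. Its integral is at most \<open>S c b\<close>, while
  the level \<open>c + a\<close> of the shifted function contributes at least \<open>S (c + a) b\<close>. A second point is
  what makes room for \<open>b < 1\<close>, since \<open>{p}\<close> must be a proper subset of the space.
\<close>

section \<open>Semicopulas and terms of the integral\<close>

lemma semicopula_mono:
  assumes "semicopula S" "x \<in> {0..1}" "x' \<in> {0..1}" "y \<in> {0..1}" "y' \<in> {0..1}" "x \<le> x'" "y \<le> y'"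
  shows "S x y \<le> S x' y'"
proof -
  have "S x y \<le> S x' y"
    using assms unfolding semicopula_def mono_on_def by blast
  also have "\<dots> \<le> S x' y'"
    using assms unfolding semicopula_def mono_on_def by blast
  finally show ?thesis .
qed

lemma semicopula_le_left:
  assumes "semicopula S" "x \<in> {0..1}" "y \<in> {0..1}"
  shows "S x y \<le> x"
proof -
  have "S x y \<le> S x 1"
    using assms(2,3) by (intro semicopula_mono[OF assms(1)]) simp_all
  also have "\<dots> = x"
    using assms(1,2) unfolding semicopula_def by blast
  finally show ?thesis .
qed

lemma semicopula_le_right:
  assumes "semicopula S" "x \<in> {0..1}" "y \<in> {0..1}"
  shows "S x y \<le> y"
proof -
  have "S x y \<le> S 1 y"
    using assms(2,3) by (intro semicopula_mono[OF assms(1)]) simp_all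
  also have "\<dots> = y"
    using assms(1,3) unfolding semicopula_def by blast
  finally show ?thesis .
qed

lemma semicopula_range:
  assumes "semicopula S" "x \<in> {0..1}" "y \<in> {0..1}"
  shows "S x y \<in> {0..1}"
  using assms unfolding semicopula_def by blast

lemma capacity_level_range:
  fixes f :: "'a \<Rightarrow> real"
  assumes "\<mu> \<in> capacities M" "f \<in> borel_measurable M"
  shows "\<mu> {x \<in> space M. f x \<ge> t} \<in> {0..1}"
proof -
  have "{x \<in> space M. f x \<ge> t} \<in> sets M"
    using assms(2) by measurable
  with assms(1) show ?thesis unfolding capacities_def by blast
qed

lemma gen_sugeno_upper:
  assumes "semicopula S" "\<mu> \<in> capacities M" "f \<in> borel_measurable M" "t \<in> {0..1}"
  shows "S t (\<mu> {x \<in> space M. f x \<ge> t}) \<le> gen_sugeno S M \<mu> f"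
  unfolding gen_sugeno_def
proof (rule cSUP_upper[OF assms(4)])
  have "S s (\<mu> {x \<in> space M. f x \<ge> s}) \<le> 1" if "s \<in> {0..1}" for s
    using semicopula_range[OF assms(1) that capacity_level_range[OF assms(2,3)]] by simp
  then show "bdd_above ((\<lambda>s. S s (\<mu> {x \<in> space M. f x \<ge> s})) ` {0..1})"
    by (intro bdd_aboveI2) auto
qed

lemma gen_sugeno_least:
  assumes "\<And>t. t \<in> {0..1} \<Longrightarrow> S t (\<mu> {x \<in> space M. f x \<ge> t}) \<le> u"
  shows "gen_sugeno S M \<mu> f \<le> u"
  unfolding gen_sugeno_def using assms by (intro cSUP_least) auto

section \<open>Sufficiency\<close>

lemma gen_sugeno_shift_le:
  assumes S: "semicopula S"
    and shift: "\<And>b c. b \<in> {0..1} \<Longrightarrow> c \<in> {0..1} \<Longrightarrow> a + c \<in> {0..1} \<Longrightarrow> S (c + a) b \<le> S c b + a"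
    and mu: "\<mu> \<in> capacities M" and f: "f \<in> borel_measurable M" and a: "a \<in> {0..1}"
  shows "gen_sugeno S M \<mu> (\<lambda>x. f x + a) \<le> gen_sugeno S M \<mu> f + a"
proof (rule gen_sugeno_least)
  fix t :: real
  assume t: "t \<in> {0..1}"
  define m where "m = \<mu> {x \<in> space M. f x \<ge> t - a}"
  have m: "m \<in> {0..1}"
    unfolding m_def by (rule capacity_level_range[OF mu f])
  have "S t m \<le> gen_sugeno S M \<mu> f + a"
  proof (cases "a \<le> t")
    case True
    with t a have ta: "t - a \<in> {0..1}" by auto
    have "S t m \<le> S (t - a) m + a"
      using shift[OF m ta] t by simp
    also have "\<dots> \<le> gen_sugeno S M \<mu> f + a"
      using gen_sugeno_upper[OF S mu f ta] by (simp add: m_def)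
    finally show ?thesis .
  next
    case False
    have "0 \<le> S 0 (\<mu> {x \<in> space M. f x \<ge> 0})"
      using semicopula_range[OF S _ capacity_level_range[OF mu f]] by simp
    also have "\<dots> \<le> gen_sugeno S M \<mu> f"
      by (rule gen_sugeno_upper[OF S mu f]) simp
    finally have "0 \<le> gen_sugeno S M \<mu> f" .
    with semicopula_le_left[OF S t m] False show ?thesis by linarith
  qed
  moreover have "{x \<in> space M. f x + a \<ge> t} = {x \<in> space M. f x \<ge> t - a}"
    by auto
  ultimately show "S t (\<mu> {x \<in> space M. f x + a \<ge> t}) \<le> gen_sugeno S M \<mu> f + a"
    by (simp add: m_def)
qed

section \<open>Necessity\<close>

definition point_capacity :: "'a \<Rightarrow> real \<Rightarrow> 'a set \<Rightarrow> real" where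
  "point_capacity p b A = (if A = UNIV then 1 else if p \<in> A then b else 0)"

lemma point_capacity_in_capacities:
  assumes "b \<in> {0..1}"
  shows "point_capacity p b \<in> capacities (count_space UNIV)"
  using assms unfolding capacities_def point_capacity_def mono_on_def by auto

lemma point_capacity_ge:
  assumes "p \<in> A" "b \<in> {0..1}"
  shows "b \<le> point_capacity p b A"
  using assms unfolding point_capacity_def by auto

text \<open>
  Up to level \<open>c\<close> the level sets are \<open>{p}\<close>, except for the whole space at level \<open>0\<close>; beyond \<open>c\<close>
  they are empty. Both exceptions contribute nothing, as \<open>S 0 y = S x 0 = 0\<close>.
\<close>

lemma gen_sugeno_point_le:
  fixes p q :: 'a
  assumes S: "semicopula S" and b: "b \<in> {0..1}" and c: "c \<in> {0..1}" and "p \<noteq> q"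
  shows "gen_sugeno S (count_space UNIV) (point_capacity p b) (\<lambda>x. if x = p then c else 0) \<le> S c b"
proof (rule gen_sugeno_least)
  fix t :: real
  assume t: "t \<in> {0..1}"
  let ?L = "{x \<in> space (count_space UNIV). (if x = p then c else 0) \<ge> t}"
  have nonneg: "0 \<le> S c b"
    using semicopula_range[OF S c b] by simp
  consider "t = 0" | "0 < t" "t \<le> c" | "c < t" using t by fastforce
  then show "S t (point_capacity p b ?L) \<le> S c b"
  proof cases
    case 1
    with c have "?L = UNIV" by auto
    then have "S t (point_capacity p b ?L) = S t 1"
      by (simp add: point_capacity_def)
    also have "\<dots> \<le> t" using t by (intro semicopula_le_left[OF S]) auto
    finally show ?thesis using 1 nonneg by simp
  next
    case 2
    then have "?L = {p}" by auto
    moreover have "{p} \<noteq> UNIV" using \<open>p \<noteq> q\<close> by (metis UNIV_I singletonD)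
    ultimately have "point_capacity p b ?L = b"
      by (simp add: point_capacity_def)
    with semicopula_mono[OF S t c b b] 2 show ?thesis by simp
  next
    case 3
    with c have "?L = {}" by auto
    then have "S t (point_capacity p b ?L) = S t 0"
      by (simp add: point_capacity_def)
    also have "\<dots> \<le> 0" using t by (intro semicopula_le_right[OF S]) auto
    finally show ?thesis using nonneg by simp
  qed
qed

lemma gen_sugeno_point_shift_ge:
  fixes p :: 'a
  assumes S: "semicopula S" and b: "b \<in> {0..1}" and ca: "c + a \<in> {0..1}"
  shows "S (c + a) b
    \<le> gen_sugeno S (count_space UNIV) (point_capacity p b) (\<lambda>x. (if x = p then c else 0) + a)"
proof -
  let ?L = "{x \<in> space (count_space UNIV). (if x = p then c else 0) + a \<ge> c + a}"
  note mu = point_capacity_in_capacities[OF b, of p]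
  \<comment> \<open>For \<open>c = 0\<close> the level set is the whole space, not \<open>{p}\<close>, hence only an inequality.\<close>
  have "b \<le> point_capacity p b ?L"
    using b by (intro point_capacity_ge) auto
  then have "S (c + a) b \<le> S (c + a) (point_capacity p b ?L)"
    by (intro semicopula_mono[OF S ca ca b] capacity_level_range[OF mu]) simp_all
  also have "\<dots> \<le> gen_sugeno S (count_space UNIV) (point_capacity p b)
      (\<lambda>x. (if x = p then c else 0) + a)"
    by (rule gen_sugeno_upper[OF S mu _ ca]) simp
  finally show ?thesis .
qed

section \<open>The characterization\<close>

theorem theorem2p1:
  fixes S :: "real \<Rightarrow> real \<Rightarrow> real"
  assumes "semicopula S"
    and "\<exists>x y :: 'a. x \<noteq> y"
  shows "(\<forall>M :: 'a measure. space M \<noteq> {} \<longrightarrow>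
            (\<forall>a\<in>{0..1}. \<forall>\<mu>\<in>capacities M. \<forall>f\<in>unit_measurable M.
               (\<forall>x\<in>space M. f x + a \<in> {0..1}) \<longrightarrow>
               gen_sugeno S M \<mu> (\<lambda>x. f x + a) \<le> gen_sugeno S M \<mu> f + a))
         \<longleftrightarrow>
         (\<forall>a\<in>{0..1}. \<forall>b\<in>{0..1}. \<forall>c\<in>{0..1}. a + c \<in> {0..1} \<longrightarrow>
            S (c + a) b \<le> S c b + a)"
  (is "?integral \<longleftrightarrow> ?pointwise")
proof
  assume ?pointwise
  then show ?integral
    by (intro allI ballI impI gen_sugeno_shift_le[OF assms(1)]) (simp_all add: unit_measurable_def)
next
  assume H: ?integral
  obtain p q :: 'a where pq: "p \<noteq> q" using assms(2) by blast
  show ?pointwise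
  proof (intro ballI impI)
    fix a b c :: real
    assume a: "a \<in> {0..1}" and b: "b \<in> {0..1}" and c: "c \<in> {0..1}" and ac: "a + c \<in> {0..1}"
    let ?f = "\<lambda>x. if x = p then c else 0"
    let ?I = "gen_sugeno S (count_space UNIV) (point_capacity p b)"
    have f: "?f \<in> unit_measurable (count_space UNIV)"
      using c unfolding unit_measurable_def by auto
    have range: "\<forall>x\<in>space (count_space UNIV). ?f x + a \<in> {0..1}"
      using a ac by (auto simp: add.commute)
    have "space (count_space (UNIV :: 'a set)) \<noteq> {}" by simp
    from H[rule_format, OF this a point_capacity_in_capacities[OF b] f] range
    have "?I (\<lambda>x. ?f x + a) \<le> ?I ?f + a"
      by blast
    moreover have "S (c + a) b \<le> ?I (\<lambda>x. ?f x + a)"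
      using ac by (intro gen_sugeno_point_shift_ge[OF assms(1) b]) (simp add: add.commute)
    ultimately show "S (c + a) b \<le> S c b + a"
      using gen_sugeno_point_le[OF assms(1) b c pq] by linarith
  qed
qed

end
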